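(* The equational classes $\mathcal{F}_{g,p}$ (pointed FG-quasigroups) and $\mathcal{G}$ are equivalent. The equivalence restricts to an equivalence between $\mathcal{F}_{g,m}$ and $\mathcal{G}_c$.
   Context: A quasigroup is a non-empty set $Q$ with a binary operation (written multiplicatively) such that all left translations $L_a:x\mapsto ax$ and all right translations $R_a:x\mapsto xa$ are permutations of $Q$. Juxtaposition binds more tightly than $\cdot$, so $xy\cdot zw$ means $(xy)(zw)$. In a quasigroup the maps $\alpha,\beta:Q\to Q$ are defined by $x\,\alpha(x)=x=\beta(x)\,x$. $Q$ is a left F-quasigroup if $x\cdot yz = xy\cdot\alpha(x)z$ for all $x,y,z\in Q$; a right F-quasigroup if $zy\cdot x = z\beta(x)\cdot yx$ for all $x,y,z\in Q$; an F-quasigroup if it is both. A quasigroup $(Q,\cdot)$ is isotopic to a group $(G,+)$ if there are bijections $a,b,c:Q\to G$ with $c(xy)=a(x)+b(y)$ for all $x,y\in Q$. An FG-quasigroup is an F-quasigroup isotopic to a (possibly noncommutative) group. Groups are written additively even when noncommutative; $Z(Q,+)$ denotes the center of $(Q,+)$. For a quasigroup $Q$ put $M(Q)=\{a\in Q:\ xa\cdot yx=xy\cdot ax\ \text{ for all } x,y\in Q\}$. $\mathcal{F}_{g,p}$ is the class (and category) of pairs $(Q,a)$ with $Q$ an FG-quasigroup and $a\in Q$; a homomorphism $(Q,a)\to(P,b)$ is a quasigroup homomorphism $\varphi:Q\to P$ with $\varphi(a)=b$. $\mathcal{F}_{g,m}$ is the full subclass of those $(Q,a)\in\mathcal{F}_{g,p}$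 with $a\in M(Q)$. $\mathcal{G}$ is the class (and category) of algebras $Q(+,f,g,f^{-1},g^{-1},e)$ where $(Q,+)$ is a (possibly noncommutative) group, $f,g$ are automorphisms of $(Q,+)$ with $fg=gf$, $-x+f(x)\in Z(Q,+)$ and $-x+g(x)\in Z(Q,+)$ for all $x\in Q$, and $e\in Q$; a homomorphism from $Q(+,f,g,f^{-1},g^{-1},e)$ to $P(+,h,k,h^{-1},k^{-1},e_1)$ is a group homomorphism $\varphi$ with $\varphi f=h\varphi$, $\varphi g=k\varphi$, $\varphi(e)=e_1$. $\mathcal{G}_c$ is the subclass of $\mathcal{G}$ given by $e\in Z(Q,+)$. Two such classes $\mathcal{A},\mathcal{B}$ are called equivalent if there is a biunique (one-to-one and onto) correspondence $\Phi:\mathcal{A}\to\mathcal{B}$ such that for every $A\in\mathcal{A}$ the algebras $A$ and $\Phi(A)$ have the same underlying set, and for all $A,B\in\mathcal{A}$ a mapping $\varphi:A\to B$ is an $\mathcal{A}$-homomorphism $A\to B$ if and only if it is a $\mathcal{B}$-homomorphism $\Phi(A)\to\Phi(B)$. *)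

theory Defs
  imports "HOL-Algebra.Bij"
begin

section \<open>Quasigroups and F-quasigroups\<close>

record 'a magma = "'a partial_object" +
  qmult :: "'a \<Rightarrow> 'a \<Rightarrow> 'a" (infixl \<open>\<cdot>\<index>\<close> 70)

locale quasigroup =
  fixes Q :: "('a, 'b) magma_scheme" (structure)
  assumes nonempty: "carrier Q \<noteq> {}"
    and left_translation:
      "a \<in> carrier Q \<Longrightarrow> bij_betw (\<lambda>x. a \<cdot> x) (carrier Q) (carrier Q)"
    and right_translation:
      "a \<in> carrier Q \<Longrightarrow> bij_betw (\<lambda>x. x \<cdot> a) (carrier Q) (carrier Q)"

definition qalpha :: "('a, 'b) magma_scheme \<Rightarrow> 'a \<Rightarrow> 'a" (\<open>\<alpha>\<index>\<close>)
  where "\<alpha>\<^bsub>Q\<^esub> x = (THE y. y \<in> carrier Q \<and> x \<cdot>\<^bsub>Q\<^esub> y = x)"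

definition qbeta :: "('a, 'b) magma_scheme \<Rightarrow> 'a \<Rightarrow> 'a" (\<open>\<beta>\<index>\<close>)
  where "\<beta>\<^bsub>Q\<^esub> x = (THE y. y \<in> carrier Q \<and> y \<cdot>\<^bsub>Q\<^esub> x = x)"

locale left_F_quasigroup = quasigroup +
  assumes left_F:
    "\<lbrakk>x \<in> carrier Q; y \<in> carrier Q; z \<in> carrier Q\<rbrakk>
      \<Longrightarrow> x \<cdot> (y \<cdot> z) = (x \<cdot> y) \<cdot> (\<alpha> x \<cdot> z)"

locale right_F_quasigroup = quasigroup +
  assumes right_F:
    "\<lbrakk>x \<in> carrier Q; y \<in> carrier Q; z \<in> carrier Q\<rbrakk>
      \<Longrightarrow> (z \<cdot> y) \<cdot> x = (z \<cdot> \<beta> x) \<cdot> (y \<cdot> x)"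

locale F_quasigroup = left_F_quasigroup + right_F_quasigroup

text \<open>
  Groups are those of \<open>HOL-Algebra\<close>, hence written multiplicatively although the
  mathematics is usually written additively: \<open>x \<otimes> y\<close>, \<open>inv x\<close> and \<open>\<one>\<close> stand for
  \<open>x + y\<close>, \<open>-x\<close> and \<open>0\<close>.
\<close>

definition isotopic_to ::
    "('a, 'b) magma_scheme \<Rightarrow> ('c, 'd) monoid_scheme \<Rightarrow> bool"
  where "isotopic_to Q G \<longleftrightarrow>
    (\<exists>a b c. bij_betw a (carrier Q) (carrier G) \<and>
             bij_betw b (carrier Q) (carrier G) \<and>
             bij_betw c (carrier Q) (carrier G) \<and>
             (\<forall>x\<in>carrier Q. \<forall>y\<in>carrier Q. c (x \<cdot>\<^bsub>Q\<^esub> y) = a x \<otimes>\<^bsub>G\<^esub> b y))"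

text \<open>
  The group is sought over the element type of the quasigroup. This loses nothing: a
  group isotopic to \<open>Q\<close> is in bijection with the carrier of \<open>Q\<close>, and so can be
  transported to that set.
\<close>

locale FG_quasigroup = F_quasigroup Q
  for Q :: "('a, 'b) magma_scheme" (structure) +
  assumes isotopic_to_group: "\<exists>G :: 'a monoid. group G \<and> isotopic_to Q G"

definition M_set :: "('a, 'b) magma_scheme \<Rightarrow> 'a set"
  where "M_set Q =
    {a \<in> carrier Q. \<forall>x\<in>carrier Q. \<forall>y\<in>carrier Q.
       (x \<cdot>\<^bsub>Q\<^esub> a) \<cdot>\<^bsub>Q\<^esub> (y \<cdot>\<^bsub>Q\<^esub> x) = (x \<cdot>\<^bsub>Q\<^esub> y) \<cdot>\<^bsub>Q\<^esub> (a \<cdot>\<^bsub>Q\<^esub> x)}"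


section \<open>Pointed FG-quasigroups\<close>

text \<open>
  Records carry total HOL functions, so two records may represent the same algebra and
  differ only outside the carrier. The classes of algebras below therefore require all
  operations to be extensional (with the value \<open>undefined\<close> outside the carrier); equality
  of records in a class is then equality of algebras, as is needed for one-to-one
  correspondences between classes. The type variable \<open>'a\<close> plays the role of the universe
  of sets: the underlying sets range over all subsets of \<open>'a\<close>.
\<close>

record 'a pointed_magma = "'a magma" +
  point :: 'a

definition F_gp :: "'a pointed_magma set"
  where "F_gp =
    {A. FG_quasigroup A \<and>
        qmult A \<in> carrier A \<rightarrow>\<^sub>E carrier A \<rightarrow>\<^sub>E carrier A \<and>
        point A \<in> carrier A}"

definition F_gm :: "'a pointed_magma set"
  where "F_gm = {A \<in> F_gp. point A \<in> M_set A}"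

definition F_hom ::
    "'a pointed_magma \<Rightarrow> 'a pointed_magma \<Rightarrow> ('a \<Rightarrow> 'a) set"
  where "F_hom A B =
    {\<phi> \<in> carrier A \<rightarrow> carrier B.
       (\<forall>x\<in>carrier A. \<forall>y\<in>carrier A. \<phi> (x \<cdot>\<^bsub>A\<^esub> y) = \<phi> x \<cdot>\<^bsub>B\<^esub> \<phi> y) \<and>
       \<phi> (point A) = point B}"


section \<open>Groups with two distinguished automorphisms and a distinguished element\<close>

definition group_center :: "('a, 'b) monoid_scheme \<Rightarrow> 'a set"
  where "group_center G =
    {z \<in> carrier G. \<forall>x\<in>carrier G. z \<otimes>\<^bsub>G\<^esub> x = x \<otimes>\<^bsub>G\<^esub> z}"

record 'a auts_group = "'a monoid" +
  aut_f :: "'a \<Rightarrow> 'a"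
  aut_g :: "'a \<Rightarrow> 'a"
  aut_f_inv :: "'a \<Rightarrow> 'a"
  aut_g_inv :: "'a \<Rightarrow> 'a"
  elt_e :: 'a

text \<open>
  Membership in \<open>auto\<close> already includes extensionality. The remaining component
  \<open>one\<close> is determined by \<open>mult\<close>.
\<close>

definition G_class :: "'a auts_group set"
  where "G_class =
    {A. group A \<and>
        mult A \<in> carrier A \<rightarrow>\<^sub>E carrier A \<rightarrow>\<^sub>E carrier A \<and>
        aut_f A \<in> auto A \<and>
        aut_g A \<in> auto A \<and>
        aut_f_inv A = restrict (inv_into (carrier A) (aut_f A)) (carrier A) \<and>
        aut_g_inv A = restrict (inv_into (carrier A) (aut_g A)) (carrier A) \<and>
        (\<forall>x\<in>carrier A. aut_f A (aut_g A x) = aut_g A (aut_f A x)) \<and>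
        (\<forall>x\<in>carrier A. inv\<^bsub>A\<^esub> x \<otimes>\<^bsub>A\<^esub> aut_f A x \<in> group_center A) \<and>
        (\<forall>x\<in>carrier A. inv\<^bsub>A\<^esub> x \<otimes>\<^bsub>A\<^esub> aut_g A x \<in> group_center A) \<and>
        elt_e A \<in> carrier A}"

definition G_c_class :: "'a auts_group set"
  where "G_c_class = {A \<in> G_class. elt_e A \<in> group_center A}"

definition G_hom ::
    "'a auts_group \<Rightarrow> 'a auts_group \<Rightarrow> ('a \<Rightarrow> 'a) set"
  where "G_hom A B =
    {\<phi> \<in> hom A B.
       (\<forall>x\<in>carrier A. \<phi> (aut_f A x) = aut_f B (\<phi> x)) \<and>
       (\<forall>x\<in>carrier A. \<phi> (aut_g A x) = aut_g B (\<phi> x)) \<and>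
       \<phi> (elt_e A) = elt_e B}"


section \<open>Equivalence of classes of algebras\<close>

definition class_equivalence ::
    "('a, 'b) partial_object_scheme set \<Rightarrow>
     (('a, 'b) partial_object_scheme \<Rightarrow> ('a, 'b) partial_object_scheme \<Rightarrow> ('a \<Rightarrow> 'a) set) \<Rightarrow>
     ('a, 'c) partial_object_scheme set \<Rightarrow>
     (('a, 'c) partial_object_scheme \<Rightarrow> ('a, 'c) partial_object_scheme \<Rightarrow> ('a \<Rightarrow> 'a) set) \<Rightarrow>
     (('a, 'b) partial_object_scheme \<Rightarrow> ('a, 'c) partial_object_scheme) \<Rightarrow> bool"
  where "class_equivalence \<A> hom\<A> \<B> hom\<B> \<Phi> \<longleftrightarrow>
    bij_betw \<Phi> \<A> \<B> \<and>
    (\<forall>A\<in>\<A>. carrier (\<Phi> A) = carrier A) \<and>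
    (\<forall>A\<in>\<A>. \<forall>B\<in>\<A>. \<forall>\<phi> \<in> carrier A \<rightarrow> carrier B.
       \<phi> \<in> hom\<A> A B \<longleftrightarrow> \<phi> \<in> hom\<B> (\<Phi> A) (\<Phi> B))"

end

theory Submission
  imports Defs
begin

text \<open>
  In additive notation, the correspondence sends a group with commuting automorphisms
  \<open>f\<close>, \<open>g\<close> and an element \<open>e\<close> to the quasigroup with product \<open>xy = f(x) + e + g(y)\<close>,
  pointed at \<open>0\<close>. This direction is given by an explicit formula, so the proof works with it
  throughout and passes to the inverse map only at the end.

  The product satisfies the F-laws because \<open>f\<close> and \<open>g\<close> move every element by a central one:
  conjugation by \<open>f(u)\<close> equals conjugation by \<open>u\<close>, which cancels all the extra terms
  (\<open>central_automorphisms.qprod_left_F\<close>; the right law is the left law in the opposite group).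

  Conversely, let \<open>Q\<close> be isotopic to a group and \<open>a \<in> Q\<close>. Transport of the group structure along
  the isotopy, followed by a translation, makes \<open>Q\<close> itself a group with neutral element \<open>a\<close>, and
  normalizing the isotopy gives \<open>xy = f(x) + e + g(y)\<close> with permutations \<open>f\<close>, \<open>g\<close> that fix \<open>a\<close>
  (\<open>FG_quasigroup.linear_form\<close>). The left F-law at \<open>x = 0\<close> says that \<open>g\<close> is the main component
  of a homotopy of the group, and a homotopy component fixing \<open>0\<close> is a homomorphism. The right
  law gives the same for \<open>f\<close>. Once both are automorphisms, the left F-law becomes an identity
  between conjugations from which the centrality of \<open>-x + f(x)\<close> and then \<open>fg = gf\<close> can be read
  off (\<open>left_F_law.commute_and_central\<close>). Hence every pointed FG-quasigroup arises.

  For homomorphisms, let \<open>\<phi>\<close> preserve the product and the point. Comparing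
  \<open>\<phi>(f(x) + e + g(y))\<close> with its values at \<open>x = 0\<close> and at \<open>y = 0\<close> shows that \<open>\<phi>\<close> is additive, and
  then it preserves \<open>f\<close>, \<open>g\<close> and \<open>e\<close> (\<open>F_hom_iff_G_hom\<close>). Applied to the identity map, this also
  proves that the group data are determined by the pointed quasigroup. Finally,
  \<open>0 \<in> M(Q)\<close> unfolds to the statement that \<open>e\<close> commutes with every \<open>gf(y)\<close>, that is, with every
  element (\<open>central_automorphisms.qprod_one_in_M_iff\<close>).
\<close>

section \<open>Opposite groups and conjugation\<close>

text \<open>
  Reversing a group multiplication exchanges the left and the right F-law of
  \<open>xy = f(x) + e + g(y)\<close> and the roles of \<open>f\<close> and \<open>g\<close>; only the left-hand theory has to be developed.
\<close>

definition opposite :: "('a, 'b) monoid_scheme \<Rightarrow> ('a, 'b) monoid_scheme"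
  where "opposite G = G\<lparr>mult := \<lambda>x y. y \<otimes>\<^bsub>G\<^esub> x\<rparr>"

lemma opposite_simps [simp]:
  "carrier (opposite G) = carrier G"
  "x \<otimes>\<^bsub>opposite G\<^esub> y = y \<otimes>\<^bsub>G\<^esub> x"
  "\<one>\<^bsub>opposite G\<^esub> = \<one>\<^bsub>G\<^esub>"
  by (simp_all add: opposite_def)

lemma hom_opposite [simp]: "hom (opposite G) (opposite G) = hom G G"
  by (auto simp: hom_def)

lemma group_center_opposite [simp]: "group_center (opposite G) = group_center G"
  by (auto simp: group_center_def)

context group
begin

lemma cancel_inv_mult [simp]:
  "\<lbrakk>x \<in> carrier G; y \<in> carrier G\<rbrakk> \<Longrightarrow> inv x \<otimes> (x \<otimes> y) = y"
  "\<lbrakk>x \<in> carrier G; y \<in> carrier G\<rbrakk> \<Longrightarrow> x \<otimes> (inv x \<otimes> y) = y"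
  by (simp_all flip: m_assoc)

lemma group_opposite: "group (opposite G)"
proof (rule groupI)
  show "\<exists>y\<in>carrier (opposite G). y \<otimes>\<^bsub>opposite G\<^esub> x = \<one>\<^bsub>opposite G\<^esub>"
    if "x \<in> carrier (opposite G)" for x
    using that by (auto intro!: bexI[of _ "inv x"])
qed (auto simp: m_assoc)

lemma inv_opposite [simp]: "x \<in> carrier G \<Longrightarrow> inv\<^bsub>opposite G\<^esub> x = inv x"
  by (rule group.inv_equality[OF group_opposite]) auto

lemma group_center_commutes:
  "\<lbrakk>z \<in> group_center G; x \<in> carrier G\<rbrakk> \<Longrightarrow> z \<otimes> x = x \<otimes> z"
  by (simp add: group_center_def)

text \<open>
  The centrality conditions on \<open>f\<close> and \<open>g\<close> enter the calculations in this form: \<open>x\<close> and \<open>u\<close> induce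
  the same inner automorphism.
\<close>

lemma inv_mult_in_center_iff_same_conjugation:
  assumes "x \<in> carrier G" "u \<in> carrier G"
  shows "inv x \<otimes> u \<in> group_center G \<longleftrightarrow>
    (\<forall>w\<in>carrier G. u \<otimes> w \<otimes> inv u = x \<otimes> w \<otimes> inv x)"
proof -
  have "inv x \<otimes> u \<otimes> w = w \<otimes> (inv x \<otimes> u) \<longleftrightarrow> u \<otimes> w \<otimes> inv u = x \<otimes> w \<otimes> inv x"
    if "w \<in> carrier G" for w
  proof -
    have "inv x \<otimes> u \<otimes> w = w \<otimes> (inv x \<otimes> u) \<longleftrightarrow>
        x \<otimes> (inv x \<otimes> u \<otimes> w) \<otimes> inv u = x \<otimes> (w \<otimes> (inv x \<otimes> u)) \<otimes> inv u"
      using assms that by simp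
    also have "x \<otimes> (inv x \<otimes> u \<otimes> w) \<otimes> inv u = u \<otimes> w \<otimes> inv u"
      using assms that by (simp flip: m_assoc)
    also have "x \<otimes> (w \<otimes> (inv x \<otimes> u)) \<otimes> inv u = x \<otimes> w \<otimes> inv x"
      using assms that by (simp add: m_assoc)
    finally show ?thesis .
  qed
  then show ?thesis using assms by (simp add: group_center_def)
qed

text \<open>
  Passing to the opposite group turns \<open>-x + u\<close> into \<open>u - x\<close>; the two are conjugate under \<open>x\<close>, so
  the centrality condition is invariant.
\<close>

lemma mult_inv_in_center:
  assumes "inv x \<otimes> u \<in> group_center G" "x \<in> carrier G" "u \<in> carrier G"
  shows "u \<otimes> inv x \<in> group_center G"
proof -
  have "u \<otimes> inv x = x \<otimes> (inv x \<otimes> u) \<otimes> inv x"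
    using assms by simp
  also have "x \<otimes> (inv x \<otimes> u) = (inv x \<otimes> u) \<otimes> x"
    using group_center_commutes[OF assms(1,2)] by (rule sym)
  also have "(inv x \<otimes> u) \<otimes> x \<otimes> inv x = inv x \<otimes> u"
    using assms by (simp add: m_assoc)
  finally show ?thesis using assms by simp
qed

lemma bij_betw_left_mult:
  "a \<in> carrier G \<Longrightarrow> bij_betw (\<lambda>x. a \<otimes> x) (carrier G) (carrier G)"
  by (rule bij_betw_byWitness[where f' = "\<lambda>x. inv a \<otimes> x"]) (auto simp flip: m_assoc)

lemma bij_betw_right_mult:
  "a \<in> carrier G \<Longrightarrow> bij_betw (\<lambda>x. x \<otimes> a) (carrier G) (carrier G)"
  by (rule bij_betw_byWitness[where f' = "\<lambda>x. x \<otimes> inv a"]) (auto simp: m_assoc)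

end

section \<open>The left F-law over a group\<close>

text \<open>
  Setting either argument to \<open>0\<close> expresses \<open>A\<close> and \<open>B\<close> through \<open>h\<close> up to the constants \<open>A(0)\<close> and
  \<open>B(0)\<close>, and these cancel because \<open>A(0) + B(0) = h(0) = 0\<close>.
\<close>

lemma (in group) homotopy_fixing_one_is_hom:
  assumes h: "h \<in> carrier G \<rightarrow> carrier G" "h \<one> = \<one>"
    and A: "A \<in> carrier G \<rightarrow> carrier G" and B: "B \<in> carrier G \<rightarrow> carrier G"
    and split: "\<And>y z. \<lbrakk>y \<in> carrier G; z \<in> carrier G\<rbrakk> \<Longrightarrow> h (y \<otimes> z) = A y \<otimes> B z"
  shows "h \<in> hom G G"
proof (rule homI)
  have AB: "A \<one> \<in> carrier G" "B \<one> \<in> carrier G" using A B by auto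
  have AB1: "B \<one> \<otimes> A \<one> = \<one>"
    using split[of \<one> \<one>] h AB by (simp add: inv_comm)
  fix y z assume yz: "y \<in> carrier G" "z \<in> carrier G"
  then have c: "A y \<in> carrier G" "B z \<in> carrier G" using A B by auto
  have "h y \<otimes> h z = (A y \<otimes> B \<one>) \<otimes> (A \<one> \<otimes> B z)"
    using split[of y \<one>] split[of \<one> z] yz by simp
  also have "\<dots> = A y \<otimes> (B \<one> \<otimes> A \<one>) \<otimes> B z" using AB c by (simp add: m_assoc)
  also have "\<dots> = h (y \<otimes> z)" using AB1 c yz split by simp
  finally show "h (y \<otimes> z) = h y \<otimes> h z" ..
qed (use h in auto)

text \<open>
  The left F-law for the product \<open>f(x) + e + g(y)\<close>, with an arbitrary map \<open>t\<close> in place of \<open>\<alpha>\<close>: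
  the values that matter are forced by the law itself at \<open>y = 0\<close>.
\<close>

locale left_F_law = group G for G (structure) +
  fixes f g t :: "'a \<Rightarrow> 'a" and e :: 'a
  assumes f_bij: "bij_betw f (carrier G) (carrier G)" and f_one: "f \<one> = \<one>"
    and g_bij: "bij_betw g (carrier G) (carrier G)" and g_one: "g \<one> = \<one>"
    and e_closed [simp]: "e \<in> carrier G"
    and t_closed [simp]: "x \<in> carrier G \<Longrightarrow> t x \<in> carrier G"
    and law: "\<lbrakk>x \<in> carrier G; y \<in> carrier G; z \<in> carrier G\<rbrakk> \<Longrightarrow>
      f x \<otimes> e \<otimes> g (f y \<otimes> e \<otimes> g z) = f (f x \<otimes> e \<otimes> g y) \<otimes> e \<otimes> g (f (t x) \<otimes> e \<otimes> g z)"
begin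

lemma f_closed [simp]: "x \<in> carrier G \<Longrightarrow> f x \<in> carrier G"
  using f_bij by (auto simp: bij_betw_def)

lemma g_closed [simp]: "x \<in> carrier G \<Longrightarrow> g x \<in> carrier G"
  using g_bij by (auto simp: bij_betw_def)

text \<open>
  At \<open>x = 0\<close> the law reads \<open>e + g(f(y) + e + g(z)) = f(e + g(y)) + e + g(ft(0) + e + g(z))\<close>. Since
  \<open>f(y) + e\<close> and \<open>g(z)\<close> run through the whole group independently, this is a homotopy whose main
  component is \<open>g\<close>.
\<close>

lemma g_hom: "g \<in> hom G G"
proof -
  let ?p = "\<lambda>y. inv_into (carrier G) f (y \<otimes> inv e)"
  let ?q = "inv_into (carrier G) g"
  have p: "?p y \<in> carrier G" "f (?p y) \<otimes> e = y" if "y \<in> carrier G" for y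
    using that f_bij bij_betw_inv_into_right[OF f_bij, of "y \<otimes> inv e"]
    by (auto simp: bij_betw_def m_assoc intro: inv_into_into)
  have q: "?q z \<in> carrier G" "g (?q z) = z" if "z \<in> carrier G" for z
    using that g_bij bij_betw_inv_into_right[OF g_bij, of z]
    by (auto simp: bij_betw_def intro: inv_into_into)
  show ?thesis
  proof (rule homotopy_fixing_one_is_hom)
    fix y z assume yz: "y \<in> carrier G" "z \<in> carrier G"
    have "e \<otimes> g (y \<otimes> z) = f (e \<otimes> g (?p y)) \<otimes> e \<otimes> g (f (t \<one>) \<otimes> e \<otimes> z)"
      using law[of \<one> "?p y" "?q z"] yz p q by (simp add: f_one)
    then show "g (y \<otimes> z) =
        (inv e \<otimes> f (e \<otimes> g (?p y)) \<otimes> e) \<otimes> g (f (t \<one>) \<otimes> e \<otimes> z)"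
      using yz p by (simp add: m_assoc inv_solve_left)
  qed (use p g_one in auto)
qed

text \<open>
  Taking \<open>y = 0\<close> determines \<open>gft(x)\<close>, and substituting it back eliminates \<open>t\<close>. The case \<open>x = 0\<close> of
  the result expresses \<open>gf(y)\<close> as a conjugate of \<open>fg(y)\<close>; with this inserted, the general case says
  that \<open>f(x)\<close> and \<open>f(f(x))\<close> induce the same inner automorphism. Surjectivity of \<open>f\<close> then gives the
  centrality, and centrality of \<open>-e + f(e)\<close> turns the conjugation in the case \<open>x = 0\<close> into the
  identity.
\<close>

lemma commute_and_central:
  assumes f_hom: "f \<in> hom G G"
  shows commute: "y \<in> carrier G \<Longrightarrow> f (g y) = g (f y)"
    and central: "x \<in> carrier G \<Longrightarrow> inv x \<otimes> f x \<in> group_center G"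
proof -
  interpret f: group_hom G G f by unfold_locales (rule f_hom)
  interpret g: group_hom G G g by unfold_locales (rule g_hom)
  have fg_surj: "\<exists>y\<in>carrier G. f (g y) = w" if "w \<in> carrier G" for w
    using that f_bij g_bij unfolding bij_betw_def by (metis (no_types, lifting) imageE)
  have law': "f x \<otimes> e \<otimes> g (f y) = f (f x) \<otimes> f e \<otimes> f (g y) \<otimes> e \<otimes> g (f (t x))"
    if "x \<in> carrier G" "y \<in> carrier G" for x y
  proof -
    have "f x \<otimes> e \<otimes> g (f y) \<otimes> g e = f (f x) \<otimes> f e \<otimes> f (g y) \<otimes> e \<otimes> g (f (t x)) \<otimes> g e"
      using law[of x y \<one>] that by (simp add: m_assoc)
    then show ?thesis using that by simp
  qed
  have gft: "e \<otimes> g (f (t x)) = inv (f e) \<otimes> inv (f (f x)) \<otimes> f x \<otimes> e"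
    if "x \<in> carrier G" for x
  proof -
    have "f x \<otimes> e = f (f x) \<otimes> (f e \<otimes> (e \<otimes> g (f (t x))))"
      using law'[of x \<one>] that by (simp add: m_assoc)
    then show ?thesis using that by (simp add: m_assoc)
  qed
  have twisted: "f x \<otimes> e \<otimes> g (f y) =
      f (f x) \<otimes> (f e \<otimes> f (g y) \<otimes> inv (f e)) \<otimes> inv (f (f x)) \<otimes> f x \<otimes> e"
    if "x \<in> carrier G" "y \<in> carrier G" for x y
    using law'[of x y] gft[of x] that by (simp add: m_assoc)
  have e_gf: "e \<otimes> g (f y) = (f e \<otimes> f (g y) \<otimes> inv (f e)) \<otimes> e"
    if "y \<in> carrier G" for y
    using twisted[of \<one> y] that by simp
  have same_conj: "f (f x) \<otimes> w \<otimes> inv (f (f x)) = f x \<otimes> w \<otimes> inv (f x)"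
    if x: "x \<in> carrier G" and w: "w \<in> carrier G" for x w
  proof -
    \<comment> \<open>With this \<open>y\<close>, the conjugate of \<open>f (g y)\<close> in \<open>twisted\<close> and \<open>e_gf\<close> is the given \<open>w\<close>.\<close>
    obtain y where y: "y \<in> carrier G" "f (g y) = inv (f e) \<otimes> w \<otimes> f e"
      using fg_surj[of "inv (f e) \<otimes> w \<otimes> f e"] w by auto
    have w_eq: "f e \<otimes> f (g y) \<otimes> inv (f e) = w"
      unfolding y using w by (simp add: m_assoc)
    have "f x \<otimes> w \<otimes> e = f (f x) \<otimes> w \<otimes> inv (f (f x)) \<otimes> f x \<otimes> e"
      using twisted[OF x y(1)] e_gf[OF y(1)] x y w w_eq by (simp add: m_assoc)
    then have "f x \<otimes> w = f (f x) \<otimes> w \<otimes> inv (f (f x)) \<otimes> f x"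
      using x w by simp
    then show ?thesis using x w by (simp add: inv_solve_right)
  qed
  show cen: "inv x \<otimes> f x \<in> group_center G" if x: "x \<in> carrier G" for x
  proof -
    obtain x' where x': "x' \<in> carrier G" "x = f x'"
      using x f_bij by (auto simp: bij_betw_def)
    show ?thesis
      using same_conj[of x'] x' by (simp add: inv_mult_in_center_iff_same_conjugation)
  qed
  show "f (g y) = g (f y)" if y: "y \<in> carrier G" for y
  proof -
    have "e \<otimes> g (f y) = (e \<otimes> f (g y) \<otimes> inv e) \<otimes> e"
      using e_gf[OF y] cen[of e] y by (simp add: inv_mult_in_center_iff_same_conjugation)
    then show ?thesis using y by (simp add: m_assoc)
  qed
qed

end

section \<open>Commuting automorphisms that act trivially modulo the center\<close>

locale central_automorphisms = group G for G (structure) +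
  fixes f g :: "'a \<Rightarrow> 'a" and e :: 'a
  assumes f_hom: "f \<in> hom G G" and f_bij: "bij_betw f (carrier G) (carrier G)"
    and g_hom: "g \<in> hom G G" and g_bij: "bij_betw g (carrier G) (carrier G)"
    and commute: "x \<in> carrier G \<Longrightarrow> f (g x) = g (f x)"
    and f_central: "x \<in> carrier G \<Longrightarrow> inv x \<otimes> f x \<in> group_center G"
    and g_central: "x \<in> carrier G \<Longrightarrow> inv x \<otimes> g x \<in> group_center G"
    and e_closed [simp]: "e \<in> carrier G"
begin

sublocale f: group_hom G G f by unfold_locales (rule f_hom)
sublocale g: group_hom G G g by unfold_locales (rule g_hom)

abbreviation qprod :: "'a \<Rightarrow> 'a \<Rightarrow> 'a"
  where "qprod x y \<equiv> f x \<otimes> e \<otimes> g y"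

lemma opposite: "central_automorphisms (opposite G) g f e"
proof -
  interpret opp: group "opposite G" by (rule group_opposite)
  show ?thesis
    by unfold_locales
      (simp_all add: f_hom g_hom f_bij g_bij commute f_central g_central mult_inv_in_center)
qed

lemma f_conj:
  "\<lbrakk>u \<in> carrier G; w \<in> carrier G\<rbrakk> \<Longrightarrow> f u \<otimes> w \<otimes> inv (f u) = u \<otimes> w \<otimes> inv u"
  using f_central[of u] by (simp add: inv_mult_in_center_iff_same_conjugation)

text \<open>
  The element \<open>t\<close> is \<open>\<alpha>(x)\<close>. Substituting \<open>g(t) = -e - f(x) + x\<close> turns the right-hand side into
  nested conjugations by \<open>f(e)\<close> and \<open>f(f(x))\<close>. These may be replaced by \<open>e\<close> and \<open>f(x)\<close>, after which
  everything superfluous cancels.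
\<close>

lemma qprod_left_F:
  assumes c: "x \<in> carrier G" "y \<in> carrier G" "z \<in> carrier G" "t \<in> carrier G"
    and t: "qprod x t = x"
  shows "qprod x (qprod y z) = qprod (qprod x y) (qprod t z)"
proof -
  have "inv e \<otimes> inv (f x) \<otimes> (f x \<otimes> e \<otimes> g t) = g t"
    using c by (simp add: m_assoc)
  then have "g t = inv e \<otimes> inv (f x) \<otimes> x"
    unfolding t ..
  then have gft: "g (f t) = inv (f e) \<otimes> inv (f (f x)) \<otimes> f x"
    using c by (simp flip: commute)
  have "f (f x) \<otimes> f e \<otimes> f (g y) \<otimes> e \<otimes> g (f t) =
      f (f x) \<otimes> (f e \<otimes> (f (g y) \<otimes> e) \<otimes> inv (f e)) \<otimes> inv (f (f x)) \<otimes> f x"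
    unfolding gft using c by (simp add: m_assoc)
  also have "\<dots> = f (f x) \<otimes> (e \<otimes> (f (g y) \<otimes> e) \<otimes> inv e) \<otimes> inv (f (f x)) \<otimes> f x"
    using c by (simp add: f_conj)
  also have "\<dots> = f x \<otimes> (e \<otimes> (f (g y) \<otimes> e) \<otimes> inv e) \<otimes> inv (f x) \<otimes> f x"
    using c by (simp add: f_conj)
  also have "\<dots> = f x \<otimes> e \<otimes> g (f y)"
    using c by (simp add: m_assoc commute)
  finally have key: "f (f x) \<otimes> f e \<otimes> f (g y) \<otimes> e \<otimes> g (f t) = f x \<otimes> e \<otimes> g (f y)" .
  have "qprod (qprod x y) (qprod t z) =
      (f (f x) \<otimes> f e \<otimes> f (g y) \<otimes> e \<otimes> g (f t)) \<otimes> g e \<otimes> g (g z)"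
    using c by (simp add: m_assoc)
  also have "\<dots> = qprod x (qprod y z)"
    unfolding key using c by (simp add: m_assoc)
  finally show ?thesis ..
qed

lemma qprod_right_F:
  assumes c: "x \<in> carrier G" "y \<in> carrier G" "z \<in> carrier G" "t \<in> carrier G"
    and t: "qprod t x = x"
  shows "qprod (qprod z y) x = qprod (qprod z t) (qprod y x)"
proof -
  interpret opp: central_automorphisms "opposite G" g f e by (rule opposite)
  show ?thesis
    using opp.qprod_left_F[of x y z t] c t by (simp add: m_assoc)
qed

lemma qprod_bij_right: "x \<in> carrier G \<Longrightarrow> bij_betw (\<lambda>y. qprod x y) (carrier G) (carrier G)"
  using bij_betw_trans[OF g_bij bij_betw_left_mult[of "f x \<otimes> e"]] by (simp add: comp_def)

lemma qprod_bij_left: "y \<in> carrier G \<Longrightarrow> bij_betw (\<lambda>x. qprod x y) (carrier G) (carrier G)"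
  using bij_betw_trans[OF f_bij bij_betw_right_mult[of "e \<otimes> g y"]]
  by (auto simp: comp_def m_assoc cong: bij_betw_cong)

text \<open>
  The two products differ only in the middle, where one has \<open>e + gf(y)\<close> and the other
  \<open>gf(y) + e\<close>.
\<close>

lemma qprod_one_in_M_iff:
  "(\<forall>x\<in>carrier G. \<forall>y\<in>carrier G.
      qprod (qprod x \<one>) (qprod y x) = qprod (qprod x y) (qprod \<one> x))
    \<longleftrightarrow> e \<in> group_center G" (is "?L \<longleftrightarrow> _")
proof -
  have "qprod (qprod x \<one>) (qprod y x) = qprod (qprod x y) (qprod \<one> x) \<longleftrightarrow>
      e \<otimes> g (f y) = g (f y) \<otimes> e" if "x \<in> carrier G" "y \<in> carrier G" for x y
  proof -
    have "qprod (qprod x \<one>) (qprod y x) =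
        f (f x) \<otimes> f e \<otimes> (e \<otimes> g (f y)) \<otimes> (g e \<otimes> g (g x))"
      using that by (simp add: m_assoc)
    moreover have "qprod (qprod x y) (qprod \<one> x) =
        f (f x) \<otimes> f e \<otimes> (g (f y) \<otimes> e) \<otimes> (g e \<otimes> g (g x))"
      using that by (simp add: m_assoc commute)
    ultimately show ?thesis using that by simp
  qed
  then have "?L \<longleftrightarrow> (\<forall>x\<in>carrier G. \<forall>y\<in>carrier G. e \<otimes> g (f y) = g (f y) \<otimes> e)"
    by (simp cong: ball_cong)
  also have "\<dots> \<longleftrightarrow> (\<forall>y\<in>carrier G. e \<otimes> g (f y) = g (f y) \<otimes> e)"
    using one_closed by blast
  also have "\<dots> \<longleftrightarrow> (\<forall>w\<in>(\<lambda>y. g (f y)) ` carrier G. e \<otimes> w = w \<otimes> e)"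
    by simp
  also have "(\<lambda>y. g (f y)) ` carrier G = carrier G"
    using bij_betw_trans[OF f_bij g_bij] by (simp add: bij_betw_def comp_def)
  finally show ?thesis by (simp add: group_center_def)
qed

end

section \<open>From a group with automorphisms to a pointed quasigroup\<close>

definition to_pointed_magma :: "'a auts_group \<Rightarrow> 'a pointed_magma"
  where "to_pointed_magma A =
    \<lparr>carrier = carrier A,
     qmult = (\<lambda>x\<in>carrier A. \<lambda>y\<in>carrier A. aut_f A x \<otimes>\<^bsub>A\<^esub> elt_e A \<otimes>\<^bsub>A\<^esub> aut_g A y),
     point = \<one>\<^bsub>A\<^esub>\<rparr>"

lemma to_pointed_magma_simps [simp]:
  "carrier (to_pointed_magma A) = carrier A"
  "point (to_pointed_magma A) = \<one>\<^bsub>A\<^esub>"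
  "\<lbrakk>x \<in> carrier A; y \<in> carrier A\<rbrakk> \<Longrightarrow>
    x \<cdot>\<^bsub>to_pointed_magma A\<^esub> y = aut_f A x \<otimes>\<^bsub>A\<^esub> elt_e A \<otimes>\<^bsub>A\<^esub> aut_g A y"
  by (simp_all add: to_pointed_magma_def)

lemma G_class_central_automorphisms:
  "A \<in> G_class \<Longrightarrow> central_automorphisms A (aut_f A) (aut_g A) (elt_e A)"
  by (simp add: G_class_def central_automorphisms_def central_automorphisms_axioms_def
      auto_def Bij_def)

lemma bij_betw_ex1:
  assumes "bij_betw h S S" "w \<in> S"
  shows "\<exists>!y. y \<in> S \<and> h y = w"
proof -
  obtain y where "y \<in> S" "h y = w" using assms unfolding bij_betw_def by (metis imageE)
  then show ?thesis using assms(1) by (auto simp: bij_betw_def dest: inj_onD)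
qed

context quasigroup
begin

lemma qmult_closed [simp]: "\<lbrakk>x \<in> carrier Q; y \<in> carrier Q\<rbrakk> \<Longrightarrow> x \<cdot> y \<in> carrier Q"
  using left_translation by (auto simp: bij_betw_def)

lemma alpha: "x \<in> carrier Q \<Longrightarrow> \<alpha> x \<in> carrier Q \<and> x \<cdot> \<alpha> x = x"
  unfolding qalpha_def by (rule theI', rule bij_betw_ex1[OF left_translation])

lemma beta: "x \<in> carrier Q \<Longrightarrow> \<beta> x \<in> carrier Q \<and> \<beta> x \<cdot> x = x"
  unfolding qbeta_def by (rule theI', rule bij_betw_ex1[OF right_translation])

end

lemma to_pointed_magma_in_F_gp:
  fixes A :: "'a auts_group"
  assumes A: "A \<in> G_class"
  shows "to_pointed_magma A \<in> F_gp"
proof -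
  interpret central_automorphisms A "aut_f A" "aut_g A" "elt_e A"
    using A by (rule G_class_central_automorphisms)
  let ?Q = "to_pointed_magma A"
  interpret Q: quasigroup ?Q
  proof
    show "carrier ?Q \<noteq> {}" using one_closed by auto
    show "bij_betw (\<lambda>x. a \<cdot>\<^bsub>?Q\<^esub> x) (carrier ?Q) (carrier ?Q)" if "a \<in> carrier ?Q" for a
      using qprod_bij_right[of a] that
        bij_betw_cong[of "carrier A" "\<lambda>x. a \<cdot>\<^bsub>?Q\<^esub> x" "\<lambda>x. qprod a x" "carrier A"] by simp
    show "bij_betw (\<lambda>x. x \<cdot>\<^bsub>?Q\<^esub> a) (carrier ?Q) (carrier ?Q)" if "a \<in> carrier ?Q" for a
      using qprod_bij_left[of a] that
        bij_betw_cong[of "carrier A" "\<lambda>x. x \<cdot>\<^bsub>?Q\<^esub> a" "\<lambda>x. qprod x a" "carrier A"] by simp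
  qed
  interpret Q: F_quasigroup ?Q
  proof
    fix x y z assume c: "x \<in> carrier ?Q" "y \<in> carrier ?Q" "z \<in> carrier ?Q"
    let ?a = "\<alpha>\<^bsub>?Q\<^esub> x" and ?b = "\<beta>\<^bsub>?Q\<^esub> x"
    have a: "?a \<in> carrier A" "x \<cdot>\<^bsub>?Q\<^esub> ?a = x"
      using Q.alpha[OF c(1)] unfolding to_pointed_magma_simps(1) by (rule conjunct1, rule conjunct2)
    have b: "?b \<in> carrier A" "?b \<cdot>\<^bsub>?Q\<^esub> x = x"
      using Q.beta[OF c(1)] unfolding to_pointed_magma_simps(1) by (rule conjunct1, rule conjunct2)
    have qa: "qprod x ?a = x"
      using to_pointed_magma_simps(1) to_pointed_magma_simps(3)[of x A ?a] a c(1) by metis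
    have qb: "qprod ?b x = x"
      using to_pointed_magma_simps(1) to_pointed_magma_simps(3)[of ?b A x] b c(1) by metis
    show "x \<cdot>\<^bsub>?Q\<^esub> (y \<cdot>\<^bsub>?Q\<^esub> z) = (x \<cdot>\<^bsub>?Q\<^esub> y) \<cdot>\<^bsub>?Q\<^esub> (\<alpha>\<^bsub>?Q\<^esub> x \<cdot>\<^bsub>?Q\<^esub> z)"
      using qprod_left_F[OF _ _ _ a(1) qa, of y z] c a(1) by simp
    show "(z \<cdot>\<^bsub>?Q\<^esub> y) \<cdot>\<^bsub>?Q\<^esub> x = (z \<cdot>\<^bsub>?Q\<^esub> \<beta>\<^bsub>?Q\<^esub> x) \<cdot>\<^bsub>?Q\<^esub> (y \<cdot>\<^bsub>?Q\<^esub> x)"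
      using qprod_right_F[OF _ _ _ b(1) qb, of y z] c b(1) by simp
  qed
  let ?G = "\<lparr>carrier = carrier A, mult = mult A, one = one A\<rparr>"
  have "group ?G" by (rule groupI) (auto simp: m_assoc intro: l_inv_ex)
  moreover have "isotopic_to ?Q ?G"
    unfolding isotopic_to_def
  proof (intro exI conjI)
    show "bij_betw (\<lambda>x. aut_f A x \<otimes>\<^bsub>A\<^esub> elt_e A) (carrier ?Q) (carrier ?G)"
      using bij_betw_trans[OF f_bij bij_betw_right_mult[OF e_closed]] by (simp add: comp_def)
    show "bij_betw (aut_g A) (carrier ?Q) (carrier ?G)" using g_bij by simp
    show "bij_betw (\<lambda>x. x) (carrier ?Q) (carrier ?G)" by (simp add: bij_betw_def)
  qed simp
  ultimately have "FG_quasigroup ?Q" by unfold_locales blast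
  then show ?thesis
    unfolding F_gp_def by (auto simp: to_pointed_magma_def)
qed

lemma to_pointed_magma_in_F_gm_iff:
  fixes A :: "'a auts_group"
  assumes A: "A \<in> G_class"
  shows "to_pointed_magma A \<in> F_gm \<longleftrightarrow> A \<in> G_c_class"
proof -
  interpret central_automorphisms A "aut_f A" "aut_g A" "elt_e A"
    using A by (rule G_class_central_automorphisms)
  show ?thesis
    using qprod_one_in_M_iff A to_pointed_magma_in_F_gp[OF A]
    by (simp add: F_gm_def G_c_class_def M_set_def cong: ball_cong)
qed

section \<open>Every pointed FG-quasigroup arises\<close>

text \<open>
  Transport along \<open>c\<close> alone would put the neutral element wherever \<open>c\<close> dictates; inserting
  \<open>-c(a)\<close> translates it to \<open>a\<close>.
\<close>

lemma group_based_at_point: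
  fixes G :: "('a, 'c) monoid_scheme" and c :: "'b \<Rightarrow> 'a"
  assumes G: "group G" and c: "bij_betw c S (carrier G)" and a: "a \<in> S"
  obtains H :: "'b monoid" where
    "group H" "carrier H = S" "\<one>\<^bsub>H\<^esub> = a" "mult H \<in> S \<rightarrow>\<^sub>E S \<rightarrow>\<^sub>E S"
    "\<And>u v. \<lbrakk>u \<in> S; v \<in> S\<rbrakk> \<Longrightarrow> c (u \<otimes>\<^bsub>H\<^esub> v) = c u \<otimes>\<^bsub>G\<^esub> inv\<^bsub>G\<^esub> c a \<otimes>\<^bsub>G\<^esub> c v"
proof -
  interpret G: group G by (rule G)
  let ?d = "inv_into S c"
  define H where "H = \<lparr>carrier = S,
    mult = (\<lambda>u\<in>S. \<lambda>v\<in>S. ?d (c u \<otimes>\<^bsub>G\<^esub> inv\<^bsub>G\<^esub> c a \<otimes>\<^bsub>G\<^esub> c v)), one = a\<rparr>"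
  have cc [simp]: "c u \<in> carrier G" if "u \<in> S" for u using c that by (auto simp: bij_betw_def)
  have dc: "?d w \<in> S" "c (?d w) = w" if "w \<in> carrier G" for w
    using c that bij_betw_inv_into_right[OF c] by (auto simp: bij_betw_def intro: inv_into_into)
  have c_eq: "u = v" if "c u = c v" "u \<in> S" "v \<in> S" for u v
    using c that by (auto simp: bij_betw_def inj_on_def)
  have [simp]: "carrier H = S" "\<one>\<^bsub>H\<^esub> = a" by (simp_all add: H_def)
  have cl [simp]: "u \<otimes>\<^bsub>H\<^esub> v \<in> S" if "u \<in> S" "v \<in> S" for u v
    using that a dc by (simp add: H_def)
  have cm: "c (u \<otimes>\<^bsub>H\<^esub> v) = c u \<otimes>\<^bsub>G\<^esub> inv\<^bsub>G\<^esub> c a \<otimes>\<^bsub>G\<^esub> c v" if "u \<in> S" "v \<in> S" for u v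
    using that a dc by (simp add: H_def)
  have "group H"
  proof (rule groupI)
    fix x y z assume "x \<in> carrier H" "y \<in> carrier H" "z \<in> carrier H"
    then show "x \<otimes>\<^bsub>H\<^esub> y \<otimes>\<^bsub>H\<^esub> z = x \<otimes>\<^bsub>H\<^esub> (y \<otimes>\<^bsub>H\<^esub> z)"
      using a by (intro c_eq) (simp_all add: cm G.m_assoc)
  next
    fix x assume x: "x \<in> carrier H"
    then show "\<one>\<^bsub>H\<^esub> \<otimes>\<^bsub>H\<^esub> x = x" using a by (intro c_eq) (simp_all add: cm)
    have "?d (c a \<otimes>\<^bsub>G\<^esub> inv\<^bsub>G\<^esub> c x \<otimes>\<^bsub>G\<^esub> c a) \<otimes>\<^bsub>H\<^esub> x = \<one>\<^bsub>H\<^esub>"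
      using a x dc by (intro c_eq) (simp_all add: cm G.m_assoc)
    moreover have "?d (c a \<otimes>\<^bsub>G\<^esub> inv\<^bsub>G\<^esub> c x \<otimes>\<^bsub>G\<^esub> c a) \<in> carrier H"
      using a x dc by simp
    ultimately show "\<exists>y\<in>carrier H. y \<otimes>\<^bsub>H\<^esub> x = \<one>\<^bsub>H\<^esub>" by blast
  qed (use a in simp_all)
  moreover have "mult H \<in> S \<rightarrow>\<^sub>E S \<rightarrow>\<^sub>E S" using a dc by (auto simp: H_def)
  ultimately show ?thesis using that cm by simp
qed

text \<open>
  For the group based at \<open>a\<close>, an isotopy gives \<open>xy = p(x) + q(y)\<close> with permutations \<open>p\<close>, \<open>q\<close>. Their
  values at \<open>a\<close> are split off and collected in \<open>e = p(a) + q(a)\<close>.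
\<close>

lemma (in FG_quasigroup) linear_form:
  fixes a :: 'a
  assumes a: "a \<in> carrier Q"
  obtains H :: "'a monoid" and f g e where
    "group H" "carrier H = carrier Q" "\<one>\<^bsub>H\<^esub> = a"
    "mult H \<in> carrier Q \<rightarrow>\<^sub>E carrier Q \<rightarrow>\<^sub>E carrier Q"
    "bij_betw f (carrier Q) (carrier Q)" "f a = a"
    "bij_betw g (carrier Q) (carrier Q)" "g a = a" "e \<in> carrier Q"
    "\<And>x y. \<lbrakk>x \<in> carrier Q; y \<in> carrier Q\<rbrakk> \<Longrightarrow> x \<cdot> y = f x \<otimes>\<^bsub>H\<^esub> e \<otimes>\<^bsub>H\<^esub> g y"
proof -
  obtain G :: "'a monoid" and A B c where G: "group G"
    and A: "bij_betw A (carrier Q) (carrier G)" and B: "bij_betw B (carrier Q) (carrier G)"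
    and c: "bij_betw c (carrier Q) (carrier G)"
    and iso: "\<And>x y. \<lbrakk>x \<in> carrier Q; y \<in> carrier Q\<rbrakk> \<Longrightarrow> c (x \<cdot> y) = A x \<otimes>\<^bsub>G\<^esub> B y"
    using isotopic_to_group unfolding isotopic_to_def by blast
  interpret G: group G by (rule G)
  obtain H :: "'a monoid" where H: "group H" "carrier H = carrier Q" "\<one>\<^bsub>H\<^esub> = a"
      "mult H \<in> carrier Q \<rightarrow>\<^sub>E carrier Q \<rightarrow>\<^sub>E carrier Q"
    and cm: "\<And>u v. \<lbrakk>u \<in> carrier Q; v \<in> carrier Q\<rbrakk> \<Longrightarrow>
      c (u \<otimes>\<^bsub>H\<^esub> v) = c u \<otimes>\<^bsub>G\<^esub> inv\<^bsub>G\<^esub> c a \<otimes>\<^bsub>G\<^esub> c v"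
    using group_based_at_point[OF G c a] by blast
  interpret H: group H by (rule H)
  let ?d = "inv_into (carrier Q) c"
  have d: "bij_betw ?d (carrier G) (carrier Q)" using c by (rule bij_betw_inv_into)
  have ca: "c a \<in> carrier G" using c a by (auto simp: bij_betw_def)
  \<comment> \<open>The translation by \<open>c a\<close> in \<open>q\<close> compensates the \<open>inv\<^bsub>G\<^esub> c a\<close> in the multiplication of \<open>H\<close>.\<close>
  define p where "p = ?d \<circ> A"
  define q where "q = ?d \<circ> ((\<lambda>w. c a \<otimes>\<^bsub>G\<^esub> w) \<circ> B)"
  have p: "bij_betw p (carrier Q) (carrier Q)"
    unfolding p_def by (rule bij_betw_trans[OF A d])
  have q: "bij_betw q (carrier Q) (carrier Q)"
    unfolding q_def
    by (rule bij_betw_trans[OF bij_betw_trans[OF B G.bij_betw_left_mult[OF ca]] d])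
  have p_cl [simp]: "p x \<in> carrier Q" and q_cl [simp]: "q x \<in> carrier Q"
    if "x \<in> carrier Q" for x
    using p q that by (auto simp: bij_betw_def)
  have pq: "x \<cdot> y = p x \<otimes>\<^bsub>H\<^esub> q y" if xy: "x \<in> carrier Q" "y \<in> carrier Q" for x y
  proof -
    have AB: "A x \<in> carrier G" "B y \<in> carrier G" using A B xy by (auto simp: bij_betw_def)
    have "c (p x \<otimes>\<^bsub>H\<^esub> q y) = A x \<otimes>\<^bsub>G\<^esub> inv\<^bsub>G\<^esub> c a \<otimes>\<^bsub>G\<^esub> (c a \<otimes>\<^bsub>G\<^esub> B y)"
      using cm[OF p_cl[OF xy(1)] q_cl[OF xy(2)]] AB ca bij_betw_inv_into_right[OF c]
      by (simp add: p_def q_def)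
    also have "\<dots> = c (x \<cdot> y)"
      using AB ca iso xy by (simp add: G.m_assoc)
    finally have "c (p x \<otimes>\<^bsub>H\<^esub> q y) = c (x \<cdot> y)" .
    moreover have "p x \<otimes>\<^bsub>H\<^esub> q y \<in> carrier Q"
      using H.m_closed[of "p x" "q y"] xy H(2) by simp
    ultimately show ?thesis
      using c xy by (auto simp: bij_betw_def inj_on_def)
  qed
  define f where "f x = p x \<otimes>\<^bsub>H\<^esub> inv\<^bsub>H\<^esub> p a" for x
  define g where "g x = inv\<^bsub>H\<^esub> q a \<otimes>\<^bsub>H\<^esub> q x" for x
  have pa: "p a \<in> carrier H" "q a \<in> carrier H" using a H(2) by auto
  show ?thesis
  proof (rule that[OF H])
    show "bij_betw f (carrier Q) (carrier Q)"
      using bij_betw_trans[OF p H.bij_betw_right_mult[OF H.inv_closed[OF pa(1)], unfolded H(2)]]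
      by (simp add: comp_def f_def[abs_def])
    show "bij_betw g (carrier Q) (carrier Q)"
      using bij_betw_trans[OF q H.bij_betw_left_mult[OF H.inv_closed[OF pa(2)], unfolded H(2)]]
      by (simp add: comp_def g_def[abs_def])
    show "f a = a" "g a = a" using pa H(3) by (simp_all add: f_def g_def)
    show "p a \<otimes>\<^bsub>H\<^esub> q a \<in> carrier Q" using pa H(2) H.m_closed by blast
    show "x \<cdot> y = f x \<otimes>\<^bsub>H\<^esub> (p a \<otimes>\<^bsub>H\<^esub> q a) \<otimes>\<^bsub>H\<^esub> g y"
      if xy: "x \<in> carrier Q" "y \<in> carrier Q" for x y
    proof -
      have "p x \<in> carrier H" "q y \<in> carrier H" using xy H(2) by auto
      then show ?thesis
        using pa pq[OF xy] by (simp add: f_def g_def H.m_assoc)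
    qed
  qed
qed

lemma (in FG_quasigroup) central_automorphisms_form:
  assumes H: "group H" "carrier H = carrier Q"
    and f: "bij_betw f (carrier Q) (carrier Q)" "f \<one>\<^bsub>H\<^esub> = \<one>\<^bsub>H\<^esub>"
    and g: "bij_betw g (carrier Q) (carrier Q)" "g \<one>\<^bsub>H\<^esub> = \<one>\<^bsub>H\<^esub>"
    and e: "e \<in> carrier Q"
    and prod: "\<And>x y. \<lbrakk>x \<in> carrier Q; y \<in> carrier Q\<rbrakk> \<Longrightarrow> x \<cdot> y = f x \<otimes>\<^bsub>H\<^esub> e \<otimes>\<^bsub>H\<^esub> g y"
  shows "central_automorphisms H f g e"
proof -
  interpret H: group H by (rule H)
  interpret opp: group "opposite H" by (rule H.group_opposite)
  note H(2) [simp]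
  have cl: "f x \<in> carrier H" "g x \<in> carrier H" if "x \<in> carrier Q" for x
    using f g that by (auto simp: bij_betw_def)
  have m: "f x \<otimes>\<^bsub>H\<^esub> e \<otimes>\<^bsub>H\<^esub> g y \<in> carrier Q" if "x \<in> carrier Q" "y \<in> carrier Q" for x y
    using qmult_closed[OF that] prod[OF that] by simp
  interpret L: left_F_law H f g "qalpha Q" e
  proof
    fix x y z assume c: "x \<in> carrier H" "y \<in> carrier H" "z \<in> carrier H"
    then show "qalpha Q x \<in> carrier H" using alpha by simp
    show "f x \<otimes>\<^bsub>H\<^esub> e \<otimes>\<^bsub>H\<^esub> g (f y \<otimes>\<^bsub>H\<^esub> e \<otimes>\<^bsub>H\<^esub> g z) =
        f (f x \<otimes>\<^bsub>H\<^esub> e \<otimes>\<^bsub>H\<^esub> g y) \<otimes>\<^bsub>H\<^esub> e \<otimes>\<^bsub>H\<^esub> g (f (qalpha Q x) \<otimes>\<^bsub>H\<^esub> e \<otimes>\<^bsub>H\<^esub> g z)"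
      using left_F[of x y z] c alpha[of x] m by (simp add: prod)
  qed (use f g e alpha in auto)
  interpret R: left_F_law "opposite H" g f "qbeta Q" e
  proof
    fix x y z assume "x \<in> carrier (opposite H)" "y \<in> carrier (opposite H)"
      "z \<in> carrier (opposite H)"
    then have c: "x \<in> carrier Q" "y \<in> carrier Q" "z \<in> carrier Q" by auto
    have assoc: "u \<otimes>\<^bsub>H\<^esub> (e \<otimes>\<^bsub>H\<^esub> v) = u \<otimes>\<^bsub>H\<^esub> e \<otimes>\<^bsub>H\<^esub> v"
      if "u \<in> carrier H" "v \<in> carrier H" for u v
      using that e by (simp add: H.m_assoc)
    have "f (f z \<otimes>\<^bsub>H\<^esub> e \<otimes>\<^bsub>H\<^esub> g y) \<otimes>\<^bsub>H\<^esub> e \<otimes>\<^bsub>H\<^esub> g x =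
        f (f z \<otimes>\<^bsub>H\<^esub> e \<otimes>\<^bsub>H\<^esub> g (qbeta Q x)) \<otimes>\<^bsub>H\<^esub> e \<otimes>\<^bsub>H\<^esub> g (f y \<otimes>\<^bsub>H\<^esub> e \<otimes>\<^bsub>H\<^esub> g x)"
      using right_F[of x y z] c beta[of x] m by (simp add: prod)
    then show "g x \<otimes>\<^bsub>opposite H\<^esub> e \<otimes>\<^bsub>opposite H\<^esub>
          f (g y \<otimes>\<^bsub>opposite H\<^esub> e \<otimes>\<^bsub>opposite H\<^esub> f z) =
        g (g x \<otimes>\<^bsub>opposite H\<^esub> e \<otimes>\<^bsub>opposite H\<^esub> f y) \<otimes>\<^bsub>opposite H\<^esub> e \<otimes>\<^bsub>opposite H\<^esub>
          f (g (qbeta Q x) \<otimes>\<^bsub>opposite H\<^esub> e \<otimes>\<^bsub>opposite H\<^esub> f z)"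
      using c m cl beta[of x] by (simp add: assoc)
  qed (use f g e beta in auto)
  have f_hom: "f \<in> hom H H" using R.g_hom by simp
  show ?thesis
  proof
    show "inv\<^bsub>H\<^esub> x \<otimes>\<^bsub>H\<^esub> g x \<in> group_center H" if x: "x \<in> carrier H" for x
      using opp.mult_inv_in_center[of x "g x"] R.central[of x] L.g_hom x cl[of x] by simp
  qed (use f g e f_hom L.g_hom L.commute[OF f_hom] L.central[OF f_hom] in auto)
qed

lemma to_pointed_magma_surj:
  fixes Q :: "'a pointed_magma"
  assumes Q: "Q \<in> F_gp"
  shows "\<exists>A\<in>G_class. to_pointed_magma A = Q"
proof -
  have FG: "FG_quasigroup Q" and Q_ext: "qmult Q \<in> carrier Q \<rightarrow>\<^sub>E carrier Q \<rightarrow>\<^sub>E carrier Q"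
    and pt: "point Q \<in> carrier Q"
    using Q by (auto simp: F_gp_def)
  interpret FG_quasigroup Q by (rule FG)
  obtain H :: "'a monoid" and f g e where H: "group H" "carrier H = carrier Q" "\<one>\<^bsub>H\<^esub> = point Q"
    "mult H \<in> carrier Q \<rightarrow>\<^sub>E carrier Q \<rightarrow>\<^sub>E carrier Q"
    and f: "bij_betw f (carrier Q) (carrier Q)" "f (point Q) = point Q"
    and g: "bij_betw g (carrier Q) (carrier Q)" "g (point Q) = point Q"
    and e: "e \<in> carrier Q"
    and prod: "\<And>x y. \<lbrakk>x \<in> carrier Q; y \<in> carrier Q\<rbrakk> \<Longrightarrow>
      x \<cdot>\<^bsub>Q\<^esub> y = f x \<otimes>\<^bsub>H\<^esub> e \<otimes>\<^bsub>H\<^esub> g y"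
    using linear_form[OF pt] by metis
  interpret H: central_automorphisms H f g e
    by (rule central_automorphisms_form) (use H f g e prod in simp_all)
  note H(2) [simp]
  let ?C = "carrier Q" and ?f = "restrict f (carrier Q)" and ?g = "restrict g (carrier Q)"
  define A where "A = \<lparr>carrier = ?C, mult = mult H, one = one H, aut_f = ?f, aut_g = ?g,
    aut_f_inv = restrict (inv_into ?C ?f) ?C, aut_g_inv = restrict (inv_into ?C ?g) ?C,
    elt_e = e\<rparr>"
  have A_sel [simp]: "carrier A = ?C" "mult A = mult H" "one A = one H"
    "aut_f A = ?f" "aut_g A = ?g" "elt_e A = e"
    by (simp_all add: A_def)
  have grp: "group A"
    by (rule groupI)
      (use H.m_closed H.one_closed H.m_assoc H.l_one H.l_inv_ex in \<open>simp_all\<close>)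
  have inv: "inv\<^bsub>A\<^esub> x = inv\<^bsub>H\<^esub> x" for x by (simp add: m_inv_def)
  have cen: "group_center A = group_center H"
    unfolding group_center_def A_sel H(2) ..
  have cl: "f x \<in> ?C" "g x \<in> ?C" if "x \<in> ?C" for x
    using that bij_betwE[OF f(1)] bij_betwE[OF g(1)] by blast+
  have aut: "restrict h ?C \<in> auto A" if "h \<in> hom H H" "bij_betw h ?C ?C" for h
    using that H.m_closed unfolding auto_def Bij_def hom_def
    by (auto simp: bij_betw_def inj_on_def)
  have "A \<in> G_class"
    unfolding G_class_def
    using grp H(4) e aut[OF H.f_hom f(1)] aut[OF H.g_hom g(1)] H.commute H.f_central H.g_central
    by (simp add: inv cen cl) (simp add: A_def)
  moreover have "to_pointed_magma A = Q"
  proof -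
    have "(\<lambda>x\<in>?C. \<lambda>y\<in>?C. ?f x \<otimes>\<^bsub>H\<^esub> e \<otimes>\<^bsub>H\<^esub> ?g y) = qmult Q"
    proof (intro ext)
      fix x y
      show "(\<lambda>x\<in>?C. \<lambda>y\<in>?C. ?f x \<otimes>\<^bsub>H\<^esub> e \<otimes>\<^bsub>H\<^esub> ?g y) x y = qmult Q x y"
        using prod[of x y] PiE_arb[OF Q_ext, of x] PiE_arb[OF PiE_mem[OF Q_ext, of x], of y]
        by (cases "x \<in> ?C"; cases "y \<in> ?C") simp_all
    qed
    then show ?thesis using H(3) by (simp add: to_pointed_magma_def)
  qed
  ultimately show ?thesis by blast
qed

section \<open>Homomorphisms\<close>

text \<open>
  In the direction from quasigroups to groups, write \<open>u = f(x) + e\<close> and \<open>v = g(y)\<close>; these are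
  arbitrary. Preservation of the product gives \<open>\<phi>(u + v) = \<phi>(u) - e' + \<phi>(e + v)\<close>, where
  \<open>e' = \<phi>(e)\<close>, and the case \<open>u = 0\<close> of this replaces \<open>-e' + \<phi>(e + v)\<close> by \<open>\<phi>(v)\<close>.
\<close>

lemma F_hom_iff_G_hom:
  assumes A: "A \<in> G_class" and B: "B \<in> G_class" and \<phi>: "\<phi> \<in> carrier A \<rightarrow> carrier B"
  shows "\<phi> \<in> F_hom (to_pointed_magma A) (to_pointed_magma B) \<longleftrightarrow> \<phi> \<in> G_hom A B"
proof
  interpret A: central_automorphisms A "aut_f A" "aut_g A" "elt_e A"
    using A by (rule G_class_central_automorphisms)
  interpret B: central_automorphisms B "aut_f B" "aut_g B" "elt_e B"
    using B by (rule G_class_central_automorphisms)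
  have cl [simp]: "\<phi> x \<in> carrier B" if "x \<in> carrier A" for x using \<phi> that by auto
  {
    assume "\<phi> \<in> G_hom A B"
    then have h: "\<phi> \<in> hom A B"
      and "\<forall>x\<in>carrier A. \<phi> (aut_f A x) = aut_f B (\<phi> x)"
        "\<forall>x\<in>carrier A. \<phi> (aut_g A x) = aut_g B (\<phi> x)" "\<phi> (elt_e A) = elt_e B"
      by (auto simp: G_hom_def)
    moreover have "\<phi> \<one>\<^bsub>A\<^esub> = \<one>\<^bsub>B\<^esub>" using hom_one[OF h] A.is_group B.is_group by simp
    ultimately show "\<phi> \<in> F_hom (to_pointed_magma A) (to_pointed_magma B)"
      using \<phi> by (simp add: F_hom_def hom_mult)
  next
    assume "\<phi> \<in> F_hom (to_pointed_magma A) (to_pointed_magma B)"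
    then have one: "\<phi> \<one>\<^bsub>A\<^esub> = \<one>\<^bsub>B\<^esub>"
      and prod: "\<And>x y. \<lbrakk>x \<in> carrier A; y \<in> carrier A\<rbrakk> \<Longrightarrow>
        \<phi> (A.qprod x y) = B.qprod (\<phi> x) (\<phi> y)"
      by (auto simp: F_hom_def)
    have e: "\<phi> (elt_e A) = elt_e B" using prod[of "\<one>\<^bsub>A\<^esub>" "\<one>\<^bsub>A\<^esub>"] one by simp
    have left: "\<phi> (aut_f A x \<otimes>\<^bsub>A\<^esub> elt_e A) = aut_f B (\<phi> x) \<otimes>\<^bsub>B\<^esub> elt_e B"
      if "x \<in> carrier A" for x
      using prod[of x "\<one>\<^bsub>A\<^esub>"] one that by simp
    have right: "\<phi> (elt_e A \<otimes>\<^bsub>A\<^esub> aut_g A y) = elt_e B \<otimes>\<^bsub>B\<^esub> aut_g B (\<phi> y)"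
      if "y \<in> carrier A" for y
      using prod[of "\<one>\<^bsub>A\<^esub>" y] one that by simp
    have split: "\<phi> (u \<otimes>\<^bsub>A\<^esub> v) = \<phi> u \<otimes>\<^bsub>B\<^esub> inv\<^bsub>B\<^esub> elt_e B \<otimes>\<^bsub>B\<^esub> \<phi> (elt_e A \<otimes>\<^bsub>A\<^esub> v)"
      if uv: "u \<in> carrier A" "v \<in> carrier A" for u v
    proof -
      obtain x where x: "x \<in> carrier A" "aut_f A x = u \<otimes>\<^bsub>A\<^esub> inv\<^bsub>A\<^esub> elt_e A"
        using A.f_bij uv unfolding bij_betw_def
        by (metis (no_types, lifting) A.e_closed A.inv_closed A.m_closed imageE)
      obtain y where y: "y \<in> carrier A" "aut_g A y = v"
        using A.g_bij uv unfolding bij_betw_def by (metis (no_types, lifting) imageE)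
      have u: "aut_f A x \<otimes>\<^bsub>A\<^esub> elt_e A = u" using x uv by (simp add: A.m_assoc)
      show ?thesis
        using prod[OF x(1) y(1)] left[OF x(1)] right[OF y(1)] x(1) y(1)
        unfolding u y(2) by (simp add: B.m_assoc)
    qed
    have translate: "\<phi> v = inv\<^bsub>B\<^esub> elt_e B \<otimes>\<^bsub>B\<^esub> \<phi> (elt_e A \<otimes>\<^bsub>A\<^esub> v)" if "v \<in> carrier A" for v
      using split[of "\<one>\<^bsub>A\<^esub>" v] one that by simp
    have mult: "\<phi> (u \<otimes>\<^bsub>A\<^esub> v) = \<phi> u \<otimes>\<^bsub>B\<^esub> \<phi> v" if "u \<in> carrier A" "v \<in> carrier A" for u v
      using split[OF that] translate[of v] that by (simp add: B.m_assoc)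
    have "\<phi> (aut_f A x) = aut_f B (\<phi> x)" "\<phi> (aut_g A x) = aut_g B (\<phi> x)" if "x \<in> carrier A" for x
      using left[OF that] right[OF that] that by (simp_all add: mult e)
    then show "\<phi> \<in> G_hom A B"
      using \<phi> e mult by (simp add: G_hom_def hom_def)
  }
qed

text \<open>
  If two algebras give the same pointed quasigroup, the identity map is a homomorphism between
  them, so their operations agree on the carrier; extensionality makes the records equal.
\<close>

lemma to_pointed_magma_inj: "inj_on to_pointed_magma (G_class :: 'a auts_group set)"
proof (rule inj_onI)
  fix A B :: "'a auts_group"
  assume A: "A \<in> G_class" and B: "B \<in> G_class" and eq: "to_pointed_magma A = to_pointed_magma B"
  have C: "carrier B = carrier A" using arg_cong[OF eq, of carrier] by simp
  have one: "one B = one A" using arg_cong[OF eq, of point] by simp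
  have "(\<lambda>x. x) \<in> F_hom (to_pointed_magma A) (to_pointed_magma B)"
    unfolding eq by (simp add: F_hom_def)
  then have "(\<lambda>x. x) \<in> G_hom A B"
    using F_hom_iff_G_hom[OF A B] C by simp
  then have on_carrier: "\<And>x y. \<lbrakk>x \<in> carrier A; y \<in> carrier A\<rbrakk> \<Longrightarrow> mult A x y = mult B x y"
      "\<And>x. x \<in> carrier A \<Longrightarrow> aut_f A x = aut_f B x"
      "\<And>x. x \<in> carrier A \<Longrightarrow> aut_g A x = aut_g B x" "elt_e A = elt_e B"
    by (auto simp: G_hom_def hom_def)
  have m: "mult A \<in> carrier A \<rightarrow>\<^sub>E carrier A \<rightarrow>\<^sub>E carrier A"
      "mult B \<in> carrier A \<rightarrow>\<^sub>E carrier A \<rightarrow>\<^sub>E carrier A"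
    using A B C by (auto simp: G_class_def)
  have "mult A = mult B"
    by (rule PiE_ext[OF m], rule PiE_ext[OF PiE_mem[OF m(1)] PiE_mem[OF m(2)]])
      (simp_all add: on_carrier)
  moreover have ext: "aut_f A \<in> extensional (carrier A)" "aut_f B \<in> extensional (carrier A)"
      "aut_g A \<in> extensional (carrier A)" "aut_g B \<in> extensional (carrier A)"
    using A B C by (auto simp: G_class_def auto_def Bij_def)
  moreover have f: "aut_f A = aut_f B" and g: "aut_g A = aut_g B"
    using extensionalityI[OF ext(1,2)] extensionalityI[OF ext(3,4)] on_carrier by blast+
  moreover have "aut_f_inv A = aut_f_inv B" "aut_g_inv A = aut_g_inv B"
    using A B C f g by (auto simp: G_class_def)
  ultimately show "A = B" using C one on_carrier(4) by simp
qed

section \<open>The equivalence\<close>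

text \<open>
  The inverse is formed on the larger class \<open>\<C>\<close>, so that a single map serves both for \<open>\<C>\<close> and for
  its subclass \<open>\<B>\<close>.
\<close>

lemma class_equivalence_the_inv_into:
  assumes \<Psi>: "class_equivalence \<B> hom\<B> \<A> hom\<A> \<Psi>" and sub: "\<B> \<subseteq> \<C>" and inj: "inj_on \<Psi> \<C>"
  shows "class_equivalence \<A> hom\<A> \<B> hom\<B> (the_inv_into \<C> \<Psi>)"
proof -
  let ?\<Phi> = "the_inv_into \<C> \<Psi>"
  have bij: "bij_betw \<Psi> \<B> \<A>" using \<Psi> by (simp add: class_equivalence_def)
  have inverse: "?\<Phi> A \<in> \<B>" "\<Psi> (?\<Phi> A) = A" if "A \<in> \<A>" for A
    using that bij sub inj by (auto simp: bij_betw_def the_inv_into_f_f subset_iff)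
  have "bij_betw ?\<Phi> \<A> \<B>"
    by (rule bij_betw_byWitness[where f' = \<Psi>])
      (use inverse bij sub inj in \<open>auto simp: bij_betw_def the_inv_into_f_f subset_iff\<close>)
  moreover have carrier: "carrier (?\<Phi> A) = carrier A" if "A \<in> \<A>" for A
    using \<Psi> inverse[OF that] by (metis class_equivalence_def)
  moreover have "\<phi> \<in> hom\<A> A B \<longleftrightarrow> \<phi> \<in> hom\<B> (?\<Phi> A) (?\<Phi> B)"
    if A: "A \<in> \<A>" and B: "B \<in> \<A>" and "\<phi> \<in> carrier A \<rightarrow> carrier B" for A B \<phi>
  proof -
    have "\<phi> \<in> carrier (?\<Phi> A) \<rightarrow> carrier (?\<Phi> B)"
      using that by (simp add: carrier)
    then have "\<phi> \<in> hom\<B> (?\<Phi> A) (?\<Phi> B) \<longleftrightarrow> \<phi> \<in> hom\<A> (\<Psi> (?\<Phi> A)) (\<Psi> (?\<Phi> B))"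
      using \<Psi> inverse(1)[OF A] inverse(1)[OF B] unfolding class_equivalence_def by blast
    then show ?thesis using inverse(2)[OF A] inverse(2)[OF B] by simp
  qed
  ultimately show ?thesis unfolding class_equivalence_def by blast
qed

theorem corollary6p6:
  shows "\<exists>\<Phi> :: 'a pointed_magma \<Rightarrow> 'a auts_group.
    class_equivalence F_gp F_hom G_class G_hom \<Phi> \<and>
    class_equivalence F_gm F_hom G_c_class G_hom \<Phi>"
proof -
  have image: "to_pointed_magma ` G_class = (F_gp :: 'a pointed_magma set)"
    using to_pointed_magma_in_F_gp to_pointed_magma_surj by blast
  have image_c: "to_pointed_magma ` G_c_class = (F_gm :: 'a pointed_magma set)"
  proof -
    have "Q \<in> to_pointed_magma ` G_c_class" if "Q \<in> F_gm" for Q :: "'a pointed_magma"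
    proof -
      obtain A where "A \<in> G_class" "to_pointed_magma A = Q"
        using \<open>Q \<in> F_gm\<close> to_pointed_magma_surj[of Q] by (auto simp: F_gm_def)
      then show ?thesis using \<open>Q \<in> F_gm\<close> to_pointed_magma_in_F_gm_iff by blast
    qed
    then show ?thesis
      using to_pointed_magma_in_F_gm_iff by (auto simp: G_c_class_def)
  qed
  have sub: "G_c_class \<subseteq> (G_class :: 'a auts_group set)" by (auto simp: G_c_class_def)
  have "class_equivalence \<B> G_hom (to_pointed_magma ` \<B>) F_hom to_pointed_magma"
    if "\<B> \<subseteq> G_class" for \<B> :: "'a auts_group set"
    unfolding class_equivalence_def bij_betw_def
    using inj_on_subset[OF to_pointed_magma_inj that] F_hom_iff_G_hom that
    by (metis subsetD to_pointed_magma_simps(1))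
  from this[of G_class] this[OF sub] show ?thesis
    unfolding image image_c
    using class_equivalence_the_inv_into[OF _ _ to_pointed_magma_inj] sub by blast
qed

end
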